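(* Let $V$ be a complex vector space of finite dimension $n\ge 1$. Then the topological space $\mathbb{P}M=\mathbb{P}M(V)$ is compact.
   Context: For a subspace $W\subseteq V$ and a nonzero $A\in\mathrm{Hom}(W,V)$, $\overline{A}\in\mathbb{P}\mathrm{Hom}(W,V)$ denotes the class of $A$; $\mathbb{P}\mathrm{Hom}(W,V)$ carries the classical topology. $M$ is the set of all finite sequences $\mathcal{A}=(A_0,A_1,\ldots,A_m)$, $m\ge 0$, such that $V_0=V$, each $A_i\in\mathrm{Hom}(V_i,V)$ is nonzero, $V_{i+1}=\mathrm{Ker}(A_i)$ for $0\le i\le m$, and $V_{m+1}=0$. Write $V(\mathcal{A})_i:=V_i$. Put $\mathbb{P}\mathcal{A}:=(\overline{A_0},\ldots,\overline{A_m})$ and $\mathbb{P}M:=\{\mathbb{P}\mathcal{A}\mid\mathcal{A}\in M\}$. (The subspaces $V(\mathcal{A})_i$ depend only on $\mathbb{P}\mathcal{A}$.) Topology on $\mathbb{P}M$: for $\mathcal{A}=(A_0,\ldots,A_m)\in M$ and open neighborhoods $U_i$ of $\overline{A_i}$ in $\mathbb{P}\mathrm{Hom}(V(\mathcal{A})_i,V)$ $(0\le i\le m)$, let $U_{\mathbb{P}\mathcal{A}}(U_0,\ldots,U_m)$ be the set of $\mathbb{P}\mathcal{B}\in\mathbb{P}M$, $\mathcal{B}=(B_0,B_1,\ldots)$, such that for every $i$ there exists $j$ with $V(\mathcal{B})_j\supseteq V(\mathcal{A})_i$, $B_j|_{V(\mathcal{A})_i}\neq 0$ and $\overline{B_j|_{V(\mathcal{A})_i}}\in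 U_i$. These sets form a base of neighborhoods of $\mathbb{P}\mathcal{A}$ and define the topology of $\mathbb{P}M$. *)

theory Defs
  imports "HOL-Analysis.Analysis"
begin

text \<open>
  The complex vector space \<open>V\<close> is the whole type \<open>'v\<close>, with scalar multiplication \<open>scale\<close>.
  The finite set \<open>Basis\<close> witnesses finite dimension and supplies the coordinates that define
  the classical topology; that topology does not depend on the choice of basis.
\<close>

locale finite_dimensional_complex_space =
  finite_dimensional_vector_space scale Basis
  for scale :: "complex \<Rightarrow> 'v::ab_group_add \<Rightarrow> 'v" and Basis :: "'v set"
begin

definition classical_topology :: "'v topology" where
  "classical_topology =
     pullback_topology UNIV (\<lambda>v. \<lambda>b\<in>Basis. representation Basis v b)
       (product_topology (\<lambda>_. euclidean :: complex topology) Basis)"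

text \<open>
  A map defined only on a subspace \<open>W\<close> is represented by a function that is \<open>undefined\<close>
  outside \<open>W\<close>, as in \<open>HOL-Library.FuncSet\<close>; so restriction to \<open>W\<close> is \<open>restrict _ W\<close>.
\<close>

definition Hom :: "'v set \<Rightarrow> ('v \<Rightarrow> 'v) set" where
  "Hom W = {A \<in> extensional W.
     (\<forall>x\<in>W. \<forall>y\<in>W. A (x + y) = A x + A y) \<and> (\<forall>c. \<forall>x\<in>W. A (scale c x) = scale c (A x))}"

definition nonzero_Hom :: "'v set \<Rightarrow> ('v \<Rightarrow> 'v) set" where
  "nonzero_Hom W = Hom W - {\<lambda>x\<in>W. 0}"

text \<open>
  For finite-dimensional \<open>W\<close> the classical topology of \<open>Hom W\<close> is that of pointwise
  convergence on \<open>W\<close>: evaluation on a basis of \<open>W\<close> identifies \<open>Hom W\<close> with a power of \<open>V\<close>.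
\<close>

definition nonzero_Hom_topology :: "'v set \<Rightarrow> ('v \<Rightarrow> 'v) topology" where
  "nonzero_Hom_topology W =
     subtopology (product_topology (\<lambda>_. classical_topology) W) (nonzero_Hom W)"

definition proj_class :: "'v set \<Rightarrow> ('v \<Rightarrow> 'v) \<Rightarrow> ('v \<Rightarrow> 'v) set" where
  "proj_class W A = {\<lambda>x\<in>W. scale c (A x) | c. c \<noteq> 0}"

definition PHom :: "'v set \<Rightarrow> ('v \<Rightarrow> 'v) set set" where
  "PHom W = proj_class W ` nonzero_Hom W"

definition PHom_topology :: "'v set \<Rightarrow> ('v \<Rightarrow> 'v) set topology" where
  "PHom_topology W = topology (\<lambda>U. U \<subseteq> PHom W \<and>
     openin (nonzero_Hom_topology W) {A \<in> nonzero_Hom W. proj_class W A \<in> U})"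

text \<open>
  \<open>Vsp \<A> i\<close> is \<open>V(\<A>)\<^sub>i\<close>; it is meaningful for \<open>i \<le> length \<A>\<close>. A sequence
  \<open>(A\<^sub>0, \<dots>, A\<^sub>m)\<close> is a list of length \<open>m + 1\<close>.
\<close>

primrec Vsp :: "('v \<Rightarrow> 'v) list \<Rightarrow> nat \<Rightarrow> 'v set" where
  "Vsp \<A> 0 = UNIV"
| "Vsp \<A> (Suc i) = {x \<in> Vsp \<A> i. (\<A> ! i) x = 0}"

definition M :: "('v \<Rightarrow> 'v) list set" where
  "M = {\<A>. \<A> \<noteq> [] \<and> (\<forall>i<length \<A>. \<A> ! i \<in> nonzero_Hom (Vsp \<A> i)) \<and> Vsp \<A> (length \<A>) = {0}}"

definition proj_seq :: "('v \<Rightarrow> 'v) list \<Rightarrow> ('v \<Rightarrow> 'v) set list" where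
  "proj_seq \<A> = map (\<lambda>i. proj_class (Vsp \<A> i) (\<A> ! i)) [0..<length \<A>]"

definition PM :: "('v \<Rightarrow> 'v) set list set" where
  "PM = proj_seq ` M"

definition nbhd_family :: "('v \<Rightarrow> 'v) list \<Rightarrow> (nat \<Rightarrow> ('v \<Rightarrow> 'v) set set) \<Rightarrow> bool" where
  "nbhd_family \<A> U \<longleftrightarrow> (\<forall>i<length \<A>. openin (PHom_topology (Vsp \<A> i)) (U i) \<and>
     proj_class (Vsp \<A> i) (\<A> ! i) \<in> U i)"

definition basic_nbhd ::
    "('v \<Rightarrow> 'v) list \<Rightarrow> (nat \<Rightarrow> ('v \<Rightarrow> 'v) set set) \<Rightarrow> ('v \<Rightarrow> 'v) set list set" where
  "basic_nbhd \<A> U = {proj_seq \<B> | \<B>. \<B> \<in> M \<and>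
     (\<forall>i<length \<A>. \<exists>j<length \<B>. Vsp \<A> i \<subseteq> Vsp \<B> j \<and>
        restrict (\<B> ! j) (Vsp \<A> i) \<noteq> (\<lambda>x\<in>Vsp \<A> i. 0) \<and>
        proj_class (Vsp \<A> i) (restrict (\<B> ! j) (Vsp \<A> i)) \<in> U i)}"

text \<open>
  A set is open iff around each of its points it contains one of the basic neighborhoods.
\<close>

definition PM_topology :: "('v \<Rightarrow> 'v) set list topology" where
  "PM_topology = topology (\<lambda>S. S \<subseteq> PM \<and>
     (\<forall>\<A>\<in>M. proj_seq \<A> \<in> S \<longrightarrow> (\<exists>U. nbhd_family \<A> U \<and> basic_nbhd \<A> U \<subseteq> S)))"

lemma openin_PHom_topology:
  "openin (PHom_topology W) U \<longleftrightarrow> U \<subseteq> PHom W \<and>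
     openin (nonzero_Hom_topology W) {A \<in> nonzero_Hom W. proj_class W A \<in> U}"
proof -
  let ?P = "\<lambda>U. U \<subseteq> PHom W \<and>
     openin (nonzero_Hom_topology W) {A \<in> nonzero_Hom W. proj_class W A \<in> U}"
  have "istopology ?P"
    unfolding istopology_def
  proof (intro conjI allI impI)
    fix S T assume ST: "?P S" "?P T"
    have "{A \<in> nonzero_Hom W. proj_class W A \<in> S \<inter> T} =
      {A \<in> nonzero_Hom W. proj_class W A \<in> S} \<inter> {A \<in> nonzero_Hom W. proj_class W A \<in> T}"
      by blast
    then show "openin (nonzero_Hom_topology W) {A \<in> nonzero_Hom W. proj_class W A \<in> S \<inter> T}"
      using openin_Int[OF conjunct2[OF ST(1)] conjunct2[OF ST(2)]] by (simp only:)
  next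
    fix \<K> assume K: "\<forall>S\<in>\<K>. ?P S"
    have "{A \<in> nonzero_Hom W. proj_class W A \<in> \<Union>\<K>} =
      \<Union> ((\<lambda>S. {A \<in> nonzero_Hom W. proj_class W A \<in> S}) ` \<K>)"
      by blast
    moreover have "openin (nonzero_Hom_topology W) \<dots>"
      using K by (intro openin_Union ballI) auto
    ultimately show "openin (nonzero_Hom_topology W) {A \<in> nonzero_Hom W. proj_class W A \<in> \<Union>\<K>}"
      by (simp only:)
  next
    fix S T assume "?P S" "?P T"
    then show "S \<inter> T \<subseteq> PHom W" by (meson inf.coboundedI1)
  next
    fix \<K> assume "\<forall>S\<in>\<K>. ?P S"
    then show "\<Union>\<K> \<subseteq> PHom W" by (meson Union_least)
  qed
  then show ?thesis
    unfolding PHom_topology_def by (rule topology_inverse'[THEN fun_cong])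
qed

lemma topspace_classical_topology [simp]: "topspace classical_topology = UNIV"
  by (auto simp: classical_topology_def topspace_pullback_topology topspace_product_topology)

lemma topspace_nonzero_Hom_topology: "topspace (nonzero_Hom_topology W) = nonzero_Hom W"
  by (auto simp: nonzero_Hom_topology_def topspace_subtopology topspace_product_topology
      nonzero_Hom_def Hom_def PiE_def)

lemma topspace_PHom_topology: "topspace (PHom_topology W) = PHom W"
proof -
  have "{A \<in> nonzero_Hom W. proj_class W A \<in> PHom W} = topspace (nonzero_Hom_topology W)"
    by (auto simp: PHom_def topspace_nonzero_Hom_topology)
  then have "openin (PHom_topology W) (PHom W)"
    by (simp add: openin_PHom_topology)
  then show ?thesis
    using openin_PHom_topology[of W "topspace (PHom_topology W)"]
      openin_subset[of "PHom_topology W" "PHom W"]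
    by (simp only: openin_topspace) (rule subset_antisym, simp_all)
qed

lemma quotient_map_proj_class:
  "quotient_map (nonzero_Hom_topology W) (PHom_topology W) (proj_class W)"
  by (simp add: quotient_map_def topspace_nonzero_Hom_topology topspace_PHom_topology
      openin_PHom_topology PHom_def)

lemma openin_PM_topology:
  "openin PM_topology S \<longleftrightarrow> S \<subseteq> PM \<and>
     (\<forall>\<A>\<in>M. proj_seq \<A> \<in> S \<longrightarrow> (\<exists>U. nbhd_family \<A> U \<and> basic_nbhd \<A> U \<subseteq> S))"
proof -
  let ?P = "\<lambda>S. S \<subseteq> PM \<and>
     (\<forall>\<A>\<in>M. proj_seq \<A> \<in> S \<longrightarrow> (\<exists>U. nbhd_family \<A> U \<and> basic_nbhd \<A> U \<subseteq> S))"
  have "istopology ?P"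
    unfolding istopology_def
  proof (intro conjI allI impI ballI)
    fix S T \<A> assume ST: "?P S" "?P T" and A: "\<A> \<in> M" "proj_seq \<A> \<in> S \<inter> T"
    from ST(1) A obtain U where U: "nbhd_family \<A> U" "basic_nbhd \<A> U \<subseteq> S" by blast
    from ST(2) A obtain U' where U': "nbhd_family \<A> U'" "basic_nbhd \<A> U' \<subseteq> T" by blast
    have "nbhd_family \<A> (\<lambda>i. U i \<inter> U' i)"
      using U(1) U'(1) unfolding nbhd_family_def by (blast intro: openin_Int)
    moreover have "basic_nbhd \<A> (\<lambda>i. U i \<inter> U' i) \<subseteq> basic_nbhd \<A> U \<inter> basic_nbhd \<A> U'"
      unfolding basic_nbhd_def by blast
    ultimately show "\<exists>U. nbhd_family \<A> U \<and> basic_nbhd \<A> U \<subseteq> S \<inter> T"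
      using U(2) U'(2) by blast
  next
    fix \<K> \<A> assume K: "\<forall>S\<in>\<K>. ?P S" and A: "\<A> \<in> M" "proj_seq \<A> \<in> \<Union>\<K>"
    from A(2) obtain S where S: "S \<in> \<K>" "proj_seq \<A> \<in> S" by blast
    with K A(1) obtain U where "nbhd_family \<A> U" "basic_nbhd \<A> U \<subseteq> S" by blast
    with S(1) show "\<exists>U. nbhd_family \<A> U \<and> basic_nbhd \<A> U \<subseteq> \<Union>\<K>"
      by blast
  next
    fix S T assume "?P S" "?P T"
    then show "S \<inter> T \<subseteq> PM" by (meson inf.coboundedI1)
  next
    fix \<K> assume "\<forall>S\<in>\<K>. ?P S"
    then show "\<Union>\<K> \<subseteq> PM" by (meson Union_least)
  qed
  then show ?thesis
    unfolding PM_topology_def by (rule topology_inverse'[THEN fun_cong])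
qed

lemma topspace_PM_topology: "topspace PM_topology = PM"
proof -
  have "nbhd_family \<A> (\<lambda>i. PHom (Vsp \<A> i))" if "\<A> \<in> M" for \<A>
    using that openin_topspace[of "PHom_topology _"]
    by (auto simp: nbhd_family_def topspace_PHom_topology M_def PHom_def)
  moreover have "basic_nbhd \<A> U \<subseteq> PM" for \<A> U
    by (auto simp: basic_nbhd_def PM_def)
  ultimately have "openin PM_topology PM"
    by (auto simp: openin_PM_topology)
  then show ?thesis
    using openin_PM_topology[of "topspace PM_topology"] openin_subset[of PM_topology PM]
    by (simp only: openin_topspace) (rule subset_antisym, simp_all)
qed

end

end

theory Submission
  imports Defs
begin

text \<open>
  For every nonzero subspace \<open>W\<close>, a sequence \<open>\<B>\<close> in \<open>M\<close> has a term \<open>B\<^sub>j\<close> that is defined on \<open>W\<close>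
  and does not vanish there; its class is a point of the compact space \<open>PHom W\<close>. This sends
  \<open>\<B>\<close> to a point of the product of all the \<open>PHom W\<close>, which is compact by Tychonoff. Conversely,
  a point \<open>\<phi>\<close> of the product determines a sequence \<open>\<A>\<close> in \<open>M\<close> with classes \<open>\<phi> (V(\<A>)\<^sub>i)\<close>, and
  a basic neighborhood of \<open>\<A>\<close> is a condition on the finitely many coordinates \<open>V(\<A>)\<^sub>i\<close>, hence
  comes from an open box around \<open>\<phi>\<close>. Finitely many of these boxes cover the product.
\<close>

context finite_dimensional_complex_space
begin

subsection \<open>Compactness of the projective spaces\<close>

lemma Hom_0:
  assumes "A \<in> Hom W" "subspace W"
  shows "A 0 = 0"
proof -
  have "0 \<in> W" using assms(2) by (rule subspace_0)
  then have "A (scale 0 0) = scale 0 (A 0)"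
    using assms(1) unfolding Hom_def by blast
  then show ?thesis by simp
qed

text \<open>Linearity holds only for arguments in \<open>W\<close>, so the induction also has to
  carry the partial sums inside \<open>W\<close>.\<close>

lemma Hom_linear_combination:
  assumes A: "A \<in> Hom W" and W: "subspace W" and "finite C" "C \<subseteq> W"
  shows "A (\<Sum>c\<in>C. scale (g c) c) = (\<Sum>c\<in>C. scale (g c) (A c))"
  using assms(3,4)
proof (induction C rule: finite_induct)
  case empty
  show ?case using Hom_0[OF A W] by simp
next
  case (insert c C)
  have "c \<in> W" and sc: "scale (g c) c \<in> W" and su: "(\<Sum>c\<in>C. scale (g c) c) \<in> W"
    using insert.prems by (auto intro!: subspace_sum[OF W] subspace_scale[OF W])
  have "A (scale (g c) c + (\<Sum>c\<in>C. scale (g c) c)) =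
      A (scale (g c) c) + A (\<Sum>c\<in>C. scale (g c) c)"
    using A sc su unfolding Hom_def by blast
  moreover have "A (scale (g c) c) = scale (g c) (A c)"
    using A \<open>c \<in> W\<close> unfolding Hom_def by blast
  ultimately show ?case using insert by simp
qed

lemma nonzero_HomI:
  assumes "A \<in> Hom W" "x \<in> W" "A x \<noteq> 0"
  shows "A \<in> nonzero_Hom W"
  using assms by (auto simp: nonzero_Hom_def dest: fun_cong[of _ _ x])

lemma nonzero_HomE:
  assumes "A \<in> nonzero_Hom W"
  obtains x where "x \<in> W" "A x \<noteq> 0"
proof (rule ccontr)
  assume "\<not> thesis"
  then have "\<And>x. x \<in> W \<Longrightarrow> A x = 0" using that by blast
  moreover have "A \<in> extensional W" using assms by (simp add: nonzero_Hom_def Hom_def)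
  ultimately have "A = (\<lambda>x\<in>W. 0)" by (auto simp: extensional_def)
  then show False using assms by (simp add: nonzero_Hom_def)
qed

lemma Hom_scale:
  assumes "A \<in> Hom W" "subspace W"
  shows "(\<lambda>x\<in>W. scale c (A x)) \<in> Hom W"
  using assms by (auto simp: Hom_def subspace_add subspace_scale scale_right_distrib mult.commute)

lemma proj_class_scale:
  assumes "d \<noteq> 0"
  shows "proj_class W (\<lambda>x\<in>W. scale d (A x)) = proj_class W A"
proof (intro set_eqI iffI)
  fix B assume "B \<in> proj_class W (\<lambda>x\<in>W. scale d (A x))"
  then obtain c where "c \<noteq> 0" "B = (\<lambda>x\<in>W. scale (c * d) (A x))"
    by (auto simp: proj_class_def cong: restrict_cong)
  then show "B \<in> proj_class W A" using assms by (auto simp: proj_class_def)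
next
  fix B assume "B \<in> proj_class W A"
  then obtain c where c: "c \<noteq> 0" "B = (\<lambda>x\<in>W. scale c (A x))"
    by (auto simp: proj_class_def)
  then have "B = (\<lambda>x\<in>W. scale (c / d) ((\<lambda>x\<in>W. scale d (A x)) x))" "c / d \<noteq> 0"
    using assms by (auto cong: restrict_cong)
  then show "B \<in> proj_class W (\<lambda>x\<in>W. scale d (A x))" unfolding proj_class_def by blast
qed

text \<open>For a basis \<open>C\<close> of \<open>W\<close>, the linear map whose matrix is
  \<open>f\<close>: the image of \<open>c\<close> has \<open>b\<close>-coordinate
  \<open>f (c, b)\<close>. Indexing matrices by \<open>C \<times> Basis\<close> makes their space a
  finite product of copies of the complex plane.\<close>

definition matrix_map :: "'v set \<Rightarrow> 'v set \<Rightarrow> ('v \<times> 'v \<Rightarrow> complex) \<Rightarrow> 'v \<Rightarrow> 'v" where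
  "matrix_map W C f = (\<lambda>w\<in>W. \<Sum>b\<in>Basis. scale (\<Sum>c\<in>C. representation C w c * f (c, b)) b)"

lemma representation_Basis_sum:
  assumes "b \<in> Basis"
  shows "representation Basis (\<Sum>b\<in>Basis. scale (g b) b) b = g b"
proof -
  have "representation Basis (\<Sum>b\<in>Basis. scale (g b) b) b =
      (\<Sum>b'\<in>Basis. g b' * (if b = b' then 1 else 0))"
    by (simp add: representation_sum independent_Basis span_Basis representation_scale
        representation_basis)
  then show ?thesis using assms by (simp add: finite_Basis if_distrib cong: if_cong)
qed

lemma matrix_map_Hom:
  assumes "subspace W" "independent C" "W \<subseteq> span C"
  shows "matrix_map W C f \<in> Hom W"
proof -
  have "x \<in> span C" if "x \<in> W" for x using that assms(3) by blast
  then show ?thesis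
    using assms(1,2)
    by (auto simp: Hom_def matrix_map_def subspace_add subspace_scale representation_add
        representation_scale distrib_right sum.distrib scale_left_distrib scale_sum_right
        sum_distrib_left mult.assoc)
qed

lemma representation_matrix_map:
  assumes "w \<in> W" "b \<in> Basis"
  shows "representation Basis (matrix_map W C f w) b = (\<Sum>c\<in>C. representation C w c * f (c, b))"
  using assms by (simp add: matrix_map_def representation_Basis_sum)

text \<open>The basis vector \<open>c\<close> is a witness: its image has nonzero coordinate
  \<open>f (c, b)\<close>.\<close>

lemma matrix_map_nonzero_Hom:
  assumes "subspace W" "independent C" "W \<subseteq> span C" "finite C" "C \<subseteq> W"
    and "c \<in> C" "b \<in> Basis" "f (c, b) \<noteq> 0"
  shows "matrix_map W C f \<in> nonzero_Hom W"
proof (rule nonzero_HomI)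
  show "c \<in> W" using assms by blast
  then have "representation Basis (matrix_map W C f c) b = f (c, b)"
    using assms by (simp add: representation_matrix_map representation_basis if_distrib[of "\<lambda>x. x * _"] cong: if_cong)
  then show "matrix_map W C f c \<noteq> 0"
    using assms by (auto simp: representation_zero)
qed (rule matrix_map_Hom[OF assms(1-3)])

text \<open>Expand \<open>w\<close> in \<open>C\<close>, then each \<open>A c\<close> in
  \<open>Basis\<close>, and exchange the two sums.\<close>

lemma matrix_map_of_Hom:
  assumes "subspace W" "independent C" "W \<subseteq> span C" "finite C" "C \<subseteq> W" and A: "A \<in> Hom W"
  shows "matrix_map W C (\<lambda>(c, b)\<in>C \<times> Basis. representation Basis (A c) b) = A"
proof
  fix w
  show "matrix_map W C (\<lambda>(c, b)\<in>C \<times> Basis. representation Basis (A c) b) w = A w"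
  proof (cases "w \<in> W")
    case True
    have "A w = A (\<Sum>c\<in>C. scale (representation C w c) c)"
      using True assms by (subst sum_representation_eq) auto
    also have "\<dots> = (\<Sum>c\<in>C. scale (representation C w c) (A c))"
      using assms by (intro Hom_linear_combination) auto
    also have "\<dots> = (\<Sum>c\<in>C. scale (representation C w c)
        (\<Sum>b\<in>Basis. scale (representation Basis (A c) b) b))"
      by (simp add: sum_representation_eq independent_Basis span_Basis finite_Basis)
    also have "\<dots> = (\<Sum>b\<in>Basis. \<Sum>c\<in>C.
        scale (representation C w c * representation Basis (A c) b) b)"
      by (simp add: scale_sum_right) (rule sum.swap)
    finally show ?thesis using True by (simp add: matrix_map_def scale_sum_left)
  next
    case False
    then show ?thesis using A by (simp add: matrix_map_def Hom_def extensional_def)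
  qed
qed

text \<open>The target carries pointwise convergence, pulled back from coordinates. So it suffices
  that each coordinate of each value is a finite linear combination of matrix entries.\<close>

lemma continuous_map_matrix_map:
  assumes "finite C"
  shows "continuous_map (product_topology (\<lambda>_. euclidean) (C \<times> Basis))
    (product_topology (\<lambda>_. classical_topology) W) (matrix_map W C)"
  unfolding continuous_map_componentwise
proof (intro conjI ballI)
  show "matrix_map W C ` topspace (product_topology (\<lambda>_. euclidean) (C \<times> Basis)) \<subseteq> extensional W"
    by (auto simp: matrix_map_def)
next
  fix w assume w: "w \<in> W"
  let ?X = "product_topology (\<lambda>_. euclidean :: complex topology) (C \<times> Basis)"
  have "continuous_map ?X euclidean (\<lambda>f. representation Basis (matrix_map W C f w) b)"
    if "b \<in> Basis" for b
  proof -
    have "continuous_map ?X euclidean (\<lambda>f. f (c, b))" if "c \<in> C" for c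
      using that \<open>b \<in> Basis\<close> by (intro continuous_map_product_projection) auto
    then have "continuous_map ?X euclidean (\<lambda>f. representation C w c * f (c, b))" if "c \<in> C" for c
      using that by (simp add: continuous_map_atin tendsto_mult_left)
    then show ?thesis
      using assms unfolding representation_matrix_map[OF w that]
      by (intro continuous_map_sum) auto
  qed
  then show "continuous_map ?X classical_topology (\<lambda>f. matrix_map W C f w)"
    unfolding classical_topology_def
    by (intro continuous_map_pullback') (auto simp: continuous_map_componentwise)
qed

text \<open>Every class has a representative whose matrix has all entries in the unit disc and
  some entry equal to 1.\<close>

lemma compact_space_PHom_topology:
  assumes W: "subspace W"
  shows "compact_space (PHom_topology W)"
proof -
  obtain C where C: "C \<subseteq> W" "independent C" "W \<subseteq> span C"
    using maximal_independent_subset by blast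
  have fin: "finite C" using C(2) by (rule finiteI_independent)
  \<comment> \<open>The compact box of matrices normalised at position \<open>p\<close>. The entry 1
    there keeps the zero matrix out, so \<open>matrix_map\<close> sends the box into
    \<open>nonzero_Hom W\<close>.\<close>
  define K where "K p = (\<Pi>\<^sub>E q\<in>C \<times> Basis. if q = p then {1} else cball (0::complex) 1)" for p
  let ?X = "product_topology (\<lambda>_. euclidean :: complex topology) (C \<times> Basis)"
  let ?F = "\<lambda>f. proj_class W (matrix_map W C f)"
  have nz: "matrix_map W C f \<in> nonzero_Hom W" if f: "f \<in> K p" and p': "p \<in> C \<times> Basis" for f p
  proof -
    obtain c b where p: "p = (c, b)" "c \<in> C" "b \<in> Basis" using p' by blast
    have "f p = 1" using f p' by (auto simp: K_def PiE_iff split: if_splits)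
    then show ?thesis using matrix_map_nonzero_Hom[OF W C(2,3) fin C(1), of c b f] p by simp
  qed
  have "compactin (PHom_topology W) (?F ` K p)" if p: "p \<in> C \<times> Basis" for p
  proof -
    have "compactin ?X (K p)"
      by (auto simp: K_def compactin_PiE)
    then have "compactin (subtopology ?X (K p)) (K p)"
      by (simp add: compactin_subtopology)
    moreover have "continuous_map (subtopology ?X (K p)) (nonzero_Hom_topology W) (matrix_map W C)"
      unfolding nonzero_Hom_topology_def continuous_map_in_subtopology
      using nz p by (auto intro!: continuous_map_from_subtopology continuous_map_matrix_map fin)
    then have "continuous_map (subtopology ?X (K p)) (PHom_topology W)
        (proj_class W \<circ> matrix_map W C)"
      by (rule continuous_map_compose[OF _ quotient_imp_continuous_map[OF quotient_map_proj_class]])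
    ultimately have "compactin (PHom_topology W) ((proj_class W \<circ> matrix_map W C) ` K p)"
      by (rule image_compactin)
    then show ?thesis by (simp only: o_def)
  qed
  then have "compactin (PHom_topology W) (\<Union>p\<in>C \<times> Basis. ?F ` K p)"
    using fin finite_Basis by (intro compactin_Union) auto
  moreover have "(\<Union>p\<in>C \<times> Basis. ?F ` K p) = PHom W"
  proof
    show "(\<Union>p\<in>C \<times> Basis. ?F ` K p) \<subseteq> PHom W" using nz by (auto simp: PHom_def)
  next
    show "PHom W \<subseteq> (\<Union>p\<in>C \<times> Basis. ?F ` K p)"
    proof
      fix P assume "P \<in> PHom W"
      then obtain A where A: "A \<in> nonzero_Hom W" and P: "P = proj_class W A"
        by (auto simp: PHom_def)
      have AH: "A \<in> Hom W" using A by (simp add: nonzero_Hom_def)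
      define r where "r B = (\<lambda>(c, b)\<in>C \<times> Basis. representation Basis (B c) b)" for B
      have rA: "matrix_map W C (r A) = A"
        unfolding r_def by (rule matrix_map_of_Hom[OF W C(2,3) fin C(1) AH])
      obtain q where q: "q \<in> C \<times> Basis" "r A q \<noteq> 0"
      \<comment> \<open>\<open>A\<close> is recovered from its matrix \<open>r A\<close>, so a
        nonzero \<open>A\<close> has a nonzero entry.\<close>
      proof (rule ccontr)
        assume "\<not> thesis"
        then have "\<And>q. q \<in> C \<times> Basis \<Longrightarrow> r A q = 0" using that by blast
        then have "A x = 0" if "x \<in> W" for x
          using that by (subst rA[symmetric]) (simp add: matrix_map_def)
        then show False using nonzero_HomE[OF A] by blast
      qed
      let ?N = "(\<lambda>q. norm (r A q)) ` (C \<times> Basis)"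
      have "finite ?N" using fin finite_Basis by blast
      moreover have "?N \<noteq> {}" using q(1) by blast
      ultimately have max: "Max ?N \<in> ?N" "\<And>y. y \<in> ?N \<Longrightarrow> y \<le> Max ?N" by auto
      \<comment> \<open>\<open>p\<close> is the position of an entry of largest modulus. Dividing by
        this entry puts 1 there and all other entries into the unit disc.\<close>
      from max(1) obtain p where p: "p \<in> C \<times> Basis" and pmax: "Max ?N = norm (r A p)"
        by (rule imageE)
      have le: "norm (r A q) \<le> norm (r A p)" if "q \<in> C \<times> Basis" for q
        using max(2)[OF imageI[OF that]] pmax by simp
      define d where "d = inverse (r A p)"
      have "r A p \<noteq> 0" using le[OF q(1)] q(2) by auto
      then have d: "d \<noteq> 0" "d * r A p = 1" by (auto simp: d_def)
      define B where "B = (\<lambda>x\<in>W. scale d (A x))"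
      have "B \<in> Hom W" unfolding B_def by (rule Hom_scale[OF AH W])
      then have rB: "matrix_map W C (r B) = B"
        unfolding r_def by (rule matrix_map_of_Hom[OF W C(2,3) fin C(1)])
      have rBA: "r B q = d * r A q" if "q \<in> C \<times> Basis" for q
        using that C(1)
        by (auto simp: r_def B_def representation_scale independent_Basis span_Basis)
      have "r B \<in> K p"
        unfolding K_def
      proof (rule PiE_I)
        fix q assume q: "q \<in> C \<times> Basis"
        have "norm (r B q) \<le> 1"
          using le[OF q] \<open>r A p \<noteq> 0\<close>
          by (simp add: rBA[OF q] d_def norm_mult norm_divide norm_inverse divide_simps)
        then show "r B q \<in> (if q = p then {1} else cball 0 1)"
          using rBA[OF q] d(2) by (cases "q = p") simp_all
      next
        fix q assume "q \<notin> C \<times> Basis"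
        then show "r B q = undefined" unfolding r_def by (rule restrict_apply[THEN trans, OF if_not_P])
      qed
      moreover have "?F (r B) = P" unfolding rB unfolding P B_def by (rule proj_class_scale[OF d(1)])
      ultimately show "P \<in> (\<Union>p\<in>C \<times> Basis. ?F ` K p)" using p by blast
    qed
  qed
  ultimately show ?thesis
    by (simp add: compact_space_def topspace_PHom_topology)
qed

subsection \<open>Sequences and points of the product\<close>

text \<open>The index set of the product. The zero subspace is left out because
  \<open>PHom {0}\<close> is empty and would make the whole product empty.\<close>

definition nonzero_subspaces :: "'v set set" where
  "nonzero_subspaces = {W. subspace W \<and> W \<noteq> {0}}"

text \<open>Only the terms before \<open>i\<close> are constrained, so this also covers partial
  sequences that are not yet in \<open>M\<close>.\<close>

lemma subspace_Vsp:
  assumes "\<And>k. k < i \<Longrightarrow> \<A> ! k \<in> Hom (Vsp \<A> k)"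
  shows "subspace (Vsp \<A> i)"
  using assms
proof (induction i)
  case (Suc i)
  then have V: "subspace (Vsp \<A> i)" and H: "\<A> ! i \<in> Hom (Vsp \<A> i)" by auto
  have "(\<A> ! i) (x + y) = (\<A> ! i) x + (\<A> ! i) y" "(\<A> ! i) (scale c x) = scale c ((\<A> ! i) x)"
    if "x \<in> Vsp \<A> i" "y \<in> Vsp \<A> i" for x y c
    using H that unfolding Hom_def by blast+
  then show ?case
    using V Hom_0[OF H V] by (auto simp: subspace_def)
qed (simp add: subspace_UNIV)

lemma Vsp_nonzero_subspace:
  assumes "\<A> \<in> M" "i < length \<A>"
  shows "Vsp \<A> i \<in> nonzero_subspaces"
proof -
  have nz: "\<A> ! k \<in> nonzero_Hom (Vsp \<A> k)" if "k < length \<A>" for k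
    using assms(1) that by (simp add: M_def)
  then have sub: "subspace (Vsp \<A> i)"
    using assms(2) by (intro subspace_Vsp) (simp add: nonzero_Hom_def)
  obtain x where "x \<in> Vsp \<A> i" "(\<A> ! i) x \<noteq> 0" using nonzero_HomE nz assms(2) by blast
  moreover have "(\<A> ! i) 0 = 0" using nz[OF assms(2)] sub Hom_0 by (auto simp: nonzero_Hom_def)
  ultimately have "Vsp \<A> i \<noteq> {0}" by (metis singletonD)
  with sub show ?thesis unfolding nonzero_subspaces_def by blast
qed

text \<open>\<open>Vsp\<close> at \<open>i\<close> reads only the first \<open>i\<close> terms. The
  case \<open>i = length \<A>\<close> matters: appending a term does not change the last
  kernel.\<close>

lemma Vsp_append: "i \<le> length \<A> \<Longrightarrow> Vsp (\<A> @ \<B>) i = Vsp \<A> i"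
  by (induction i) (auto simp: nth_append)

text \<open>The subspaces of \<open>\<B>\<close> descend from the whole space to \<open>{0}\<close>.
  Take \<open>j\<close> just before the first one that fails to contain \<open>W\<close>: a vector
  of \<open>W\<close> lost at that step is not killed by term \<open>j\<close>.\<close>

lemma M_restrict_nonzero:
  assumes "\<B> \<in> M" and W: "W \<in> nonzero_subspaces"
  obtains j where "j < length \<B>" "W \<subseteq> Vsp \<B> j" "restrict (\<B> ! j) W \<in> nonzero_Hom W"
proof -
  have W': "subspace W" "W \<noteq> {0}" using W by (auto simp: nonzero_subspaces_def)
  then have "\<not> W \<subseteq> Vsp \<B> (length \<B>)"
    using assms(1) subspace_0[OF W'(1)] by (auto simp: M_def)
  moreover have "W \<subseteq> Vsp \<B> 0" by simp
  ultimately obtain j where j: "j < length \<B>" "W \<subseteq> Vsp \<B> j" "\<not> W \<subseteq> Vsp \<B> (Suc j)"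
    using ex_least_nat_less[of "\<lambda>i. \<not> W \<subseteq> Vsp \<B> i" "length \<B>"] by blast
  then obtain x where x: "x \<in> W" "(\<B> ! j) x \<noteq> 0" by auto
  have "\<B> ! j \<in> Hom (Vsp \<B> j)" using assms(1) j(1) by (simp add: M_def nonzero_Hom_def)
  then have "restrict (\<B> ! j) W \<in> Hom W"
    using j(2) by (auto simp: Hom_def subspace_add[OF W'(1)] subspace_scale[OF W'(1)] subset_iff)
  then have "restrict (\<B> ! j) W \<in> nonzero_Hom W" by (rule nonzero_HomI[OF _ x(1)]) (simp add: x)
  then show ?thesis using that j by blast
qed

text \<open>While the last kernel is nonzero, \<open>\<phi>\<close> prescribes a class on it; append
  a representative. Since that map is nonzero, the kernel shrinks strictly, so induction on its
  dimension ends the process. The arbitrary initial segment \<open>\<A>\<close> serves the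
  induction.\<close>

lemma M_extension:
  assumes "\<phi> \<in> (\<Pi>\<^sub>E W\<in>nonzero_subspaces. PHom W)" and "(UNIV :: 'v set) \<noteq> {0}"
    and "\<And>i. i < length \<A> \<Longrightarrow>
      \<A> ! i \<in> nonzero_Hom (Vsp \<A> i) \<and> \<phi> (Vsp \<A> i) = proj_class (Vsp \<A> i) (\<A> ! i)"
  shows "\<exists>\<B>\<in>M. \<forall>i<length \<B>. \<phi> (Vsp \<B> i) = proj_class (Vsp \<B> i) (\<B> ! i)"
  using assms(3)
proof (induction "dim (Vsp \<A> (length \<A>))" arbitrary: \<A> rule: less_induct)
  case less
  let ?W = "Vsp \<A> (length \<A>)"
  have W: "subspace ?W" by (rule subspace_Vsp) (use less.prems in \<open>simp add: nonzero_Hom_def\<close>)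
  show ?case
  proof (cases "?W = {0}")
    case True
    \<comment> \<open>As the whole space is not \<open>{0}\<close>, the sequence cannot be empty
      here.\<close>
    then have "\<A> \<in> M" using less.prems assms(2) by (auto simp: M_def)
    then show ?thesis using less.prems by blast
  next
    case False
    then have "\<phi> ?W \<in> PHom ?W" using assms(1) W by (auto simp: nonzero_subspaces_def PiE_iff)
    then obtain A where A: "A \<in> nonzero_Hom ?W" "\<phi> ?W = proj_class ?W A"
      by (auto simp: PHom_def)
    let ?A = "\<A> @ [A]"
    have ext: "?A ! i \<in> nonzero_Hom (Vsp ?A i) \<and> \<phi> (Vsp ?A i) = proj_class (Vsp ?A i) (?A ! i)"
      if "i < length ?A" for i
      using that less.prems[of i] A by (auto simp: nth_append Vsp_append less_Suc_eq)
    have W': "subspace (Vsp ?A (length ?A))"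
      by (rule subspace_Vsp) (use ext in \<open>simp add: nonzero_Hom_def\<close>)
    obtain x where "x \<in> ?W" "A x \<noteq> 0" using nonzero_HomE[OF A(1)] by blast
    then have "Vsp ?A (length ?A) \<subset> ?W" by (auto simp: Vsp_append)
    then have "dim (Vsp ?A (length ?A)) < dim ?W"
      using W W' by (intro dim_psubset) (metis span_eq_iff)
    then show ?thesis using less.hyps ext by blast
  qed
qed

text \<open>Relates \<open>\<B>\<close> to its point \<open>\<psi>\<close> of the product. The
  existential index has the shape of the condition in \<open>basic_nbhd\<close>, to which it is
  later transferred.\<close>

definition restricts_to :: "('v \<Rightarrow> 'v) list \<Rightarrow> ('v set \<Rightarrow> ('v \<Rightarrow> 'v) set) \<Rightarrow> bool" where
  "restricts_to \<B> \<psi> \<longleftrightarrow> (\<forall>W\<in>nonzero_subspaces. \<exists>j<length \<B>. W \<subseteq> Vsp \<B> j \<and>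
     restrict (\<B> ! j) W \<in> nonzero_Hom W \<and> \<psi> W = proj_class W (restrict (\<B> ! j) W))"

lemma M_restricts_to:
  assumes "\<B> \<in> M"
  obtains \<psi> where "\<psi> \<in> (\<Pi>\<^sub>E W\<in>nonzero_subspaces. PHom W)" "restricts_to \<B> \<psi>"
proof -
  have "\<forall>W\<in>nonzero_subspaces. \<exists>j. j < length \<B> \<and> W \<subseteq> Vsp \<B> j \<and>
      restrict (\<B> ! j) W \<in> nonzero_Hom W"
    using M_restrict_nonzero[OF assms] by metis
  then obtain j where j: "\<forall>W\<in>nonzero_subspaces. j W < length \<B> \<and> W \<subseteq> Vsp \<B> (j W) \<and>
      restrict (\<B> ! j W) W \<in> nonzero_Hom W"
    by (rule bchoice[THEN exE])
  let ?\<psi> = "\<lambda>W\<in>nonzero_subspaces. proj_class W (restrict (\<B> ! j W) W)"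
  have "?\<psi> \<in> (\<Pi>\<^sub>E W\<in>nonzero_subspaces. PHom W)" using j by (auto simp: PHom_def)
  moreover have "restricts_to \<B> ?\<psi>"
    unfolding restricts_to_def
  proof
    fix W assume "W \<in> nonzero_subspaces"
    then show "\<exists>j<length \<B>. W \<subseteq> Vsp \<B> j \<and> restrict (\<B> ! j) W \<in> nonzero_Hom W \<and>
        ?\<psi> W = proj_class W (restrict (\<B> ! j) W)"
      using j by (intro exI[of _ "j W"]) simp
  qed
  ultimately show ?thesis by (rule that)
qed

section \<open>Finite subcovers by way of the product space\<close>

lemma compact_space_PM_topology:
  assumes "(UNIV :: 'v set) \<noteq> {0}"
  shows "compact_space PM_topology"
  unfolding compact_space_alt topspace_PM_topology
proof (intro allI impI)
  fix \<U> assume \<U>: "(\<forall>S\<in>\<U>. openin PM_topology S) \<and> PM \<subseteq> \<Union>\<U>"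
  let ?P = "product_topology PHom_topology nonzero_subspaces"
  have topP: "topspace ?P = (\<Pi>\<^sub>E W\<in>nonzero_subspaces. PHom W)"
    by (simp add: topspace_product_topology topspace_PHom_topology comp_def)
  have compP: "compact_space ?P"
    by (auto simp: compact_space_product_topology nonzero_subspaces_def compact_space_PHom_topology)
  \<comment> \<open>The local form of the covering argument: all sequences attached to points of the
    box \<open>N\<close> have their classes in a single member \<open>S\<close> of the
    cover.\<close>
  have "\<exists>N S. openin ?P N \<and> \<phi> \<in> N \<and> S \<in> \<U> \<and>
      (\<forall>\<B>\<in>M. \<forall>\<psi>\<in>N. restricts_to \<B> \<psi> \<longrightarrow> proj_seq \<B> \<in> S)"
    if \<phi>: "\<phi> \<in> topspace ?P" for \<phi>
  proof -
    \<comment> \<open>\<open>\<phi>\<close> need not be attached to \<open>\<A>\<close> by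
      \<open>restricts_to\<close>; agreement at the subspaces of \<open>\<A>\<close> itself is
      enough.\<close>
    obtain \<A> where \<A>: "\<A> \<in> M"
      and \<phi>\<A>: "\<And>i. i < length \<A> \<Longrightarrow> \<phi> (Vsp \<A> i) = proj_class (Vsp \<A> i) (\<A> ! i)"
      using M_extension[of \<phi> "[]"] \<phi> topP assms by auto
    then obtain S where S: "S \<in> \<U>" "proj_seq \<A> \<in> S" "openin PM_topology S"
      using \<U> by (auto simp: PM_def)
    then obtain U where U: "nbhd_family \<A> U" "basic_nbhd \<A> U \<subseteq> S"
      using \<A> by (auto simp: openin_PM_topology)
    \<comment> \<open>One open condition for each term of \<open>\<A>\<close>: finitely many
      coordinates, so the set is open in the product topology.\<close>
    define N where "N = (\<Inter>i\<in>{..<length \<A>}. {\<psi> \<in> topspace ?P. \<psi> (Vsp \<A> i) \<in> U i}) \<inter> topspace ?P"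
    have "openin ?P N"
      unfolding N_def
    proof (rule openin_INT)
      fix i assume "i \<in> {..<length \<A>}"
      then have i: "i < length \<A>" by simp
      then show "openin ?P {\<psi> \<in> topspace ?P. \<psi> (Vsp \<A> i) \<in> U i}"
        using Vsp_nonzero_subspace[OF \<A> i] U(1) unfolding nbhd_family_def
        by (intro openin_continuous_map_preimage[OF continuous_map_product_projection]) auto
    qed simp
    moreover have "\<phi> \<in> N"
      using \<phi> \<phi>\<A> U(1) by (auto simp: N_def nbhd_family_def)
    moreover have "proj_seq \<B> \<in> S" if "\<B> \<in> M" "\<psi> \<in> N" "restricts_to \<B> \<psi>" for \<B> \<psi>
    proof -
      have "\<exists>j<length \<B>. Vsp \<A> i \<subseteq> Vsp \<B> j \<and>
          restrict (\<B> ! j) (Vsp \<A> i) \<noteq> (\<lambda>x\<in>Vsp \<A> i. 0) \<and>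
          proj_class (Vsp \<A> i) (restrict (\<B> ! j) (Vsp \<A> i)) \<in> U i" if i: "i < length \<A>" for i
      proof -
        have "\<psi> (Vsp \<A> i) \<in> U i" using \<open>\<psi> \<in> N\<close> i by (simp add: N_def)
        then show ?thesis
          using bspec[OF \<open>restricts_to \<B> \<psi>\<close>[unfolded restricts_to_def]
              Vsp_nonzero_subspace[OF \<A> i]]
          by (auto simp: nonzero_Hom_def)
      qed
      then have "proj_seq \<B> \<in> basic_nbhd \<A> U"
        using \<open>\<B> \<in> M\<close> unfolding basic_nbhd_def by blast
      then show ?thesis using U(2) by blast
    qed
    ultimately show ?thesis using S(1) by blast
  qed
  then obtain N S where NS: "\<And>\<phi>. \<phi> \<in> topspace ?P \<Longrightarrow> openin ?P (N \<phi>) \<and> \<phi> \<in> N \<phi> \<and> S \<phi> \<in> \<U> \<and>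
      (\<forall>\<B>\<in>M. \<forall>\<psi>\<in>N \<phi>. restricts_to \<B> \<psi> \<longrightarrow> proj_seq \<B> \<in> S \<phi>)"
    by metis
  have "\<forall>T\<in>N ` topspace ?P. openin ?P T" "topspace ?P \<subseteq> \<Union>(N ` topspace ?P)"
    using NS by blast+
  then obtain \<F> where "finite \<F>" "\<F> \<subseteq> N ` topspace ?P" "topspace ?P \<subseteq> \<Union>\<F>"
    using compP unfolding compact_space_alt by meson
  then obtain T where T: "finite T" "T \<subseteq> topspace ?P" "topspace ?P \<subseteq> \<Union>(N ` T)"
    by (metis finite_subset_image)
  \<comment> \<open>A point of \<open>PM\<close> is caught through a \<open>\<psi>\<close> attached
    to a sequence representing it: the box \<open>N \<phi>\<close> containing \<open>\<psi>\<close>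
    forces the point into \<open>S \<phi>\<close>.\<close>
  have "PM \<subseteq> \<Union>(S ` T)"
  proof
    fix P assume "P \<in> PM"
    then obtain \<B> where \<B>: "\<B> \<in> M" "P = proj_seq \<B>" by (auto simp: PM_def)
    obtain \<psi> where \<psi>: "\<psi> \<in> topspace ?P" "restricts_to \<B> \<psi>"
      using M_restricts_to[OF \<B>(1)] topP by metis
    then obtain \<phi> where \<phi>: "\<phi> \<in> T" "\<psi> \<in> N \<phi>" using T(3) by blast
    then have "P \<in> S \<phi>" using NS[of \<phi>] \<phi> \<psi>(2) T(2) \<B> by blast
    then show "P \<in> \<Union>(S ` T)" using \<phi>(1) by blast
  qed
  moreover have "S ` T \<subseteq> \<U>" using NS T(2) by blast
  ultimately show "\<exists>\<F>. finite \<F> \<and> \<F> \<subseteq> \<U> \<and> PM \<subseteq> \<Union>\<F>" using T(1) by blast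
qed

end

theorem theorem5p2:
  fixes scale :: "complex \<Rightarrow> 'v::ab_group_add \<Rightarrow> 'v"
    and Basis :: "'v set" and n :: nat
  assumes "finite_dimensional_complex_space scale Basis"
    and "vector_space.dim scale (UNIV :: 'v set) = n"
    and "n \<ge> 1"
  shows "compact_space (finite_dimensional_complex_space.PM_topology scale Basis)"
proof -
  interpret finite_dimensional_complex_space scale Basis by fact
  have "(UNIV :: 'v set) \<noteq> {0}"
  proof
    assume "(UNIV :: 'v set) = {0}"
    then show False using assms(2,3) dim_eq_0[of UNIV] by simp
  qed
  then show ?thesis by (rule compact_space_PM_topology)
qed

end
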